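(* There exists a GAS convergent sequence $\xi\in l_\infty$ which is neither almost convergent nor statistically convergent; i.e. $st\cup\mathcal A\subsetneq\mathcal S$.
   Context: $l_\infty$ is the normed linear space of all bounded real sequences $x=(x_n)_{n\in\mathbb N}$, $\mathbb N=\{1,2,3,\dots\}$, with the norm $\|x\|_\infty=\sup_n|x_n|$; $c\subset l_\infty$ is the subspace of convergent sequences. $S$ is the shift operator $S((x_n)_{n=1}^\infty)=(x_n)_{n=2}^\infty$. A linear functional $B:l_\infty\to\mathbb R$ is a Banach limit functional if: (i) $\|B\|=1$; (ii) $B(x)=\lim_{n\to\infty}x_n$ for all $x\in c$; (iii) $B(x)\ge0$ whenever $x\in l_\infty$ and $x_n\ge0$ for all $n$; (iv) $B(x)=B(Sx)$ for all $x\in l_\infty$. A sequence $x\in l_\infty$ is almost convergent to $\kappa$ if $B(x)=\kappa$ for all Banach limit functionals $B$. $\mathcal A$ is the set of all almost convergent real sequences. For $P\subset\mathbb N$, the natural density is $\delta(P)=\lim_{n\to\infty}\frac{|P\cap\{1,\dots,n\}|}{n}$ when the limit exists. A condition holds for "a.a.$k$" (almost all $k$) if the set $E$ of $k\in\mathbb N$ for which it fails has $\delta(E)=0$. A real sequence $(p_k)$ converges statistically to $\ell\in\mathbb R$, written $\mathrm{stat}\lim_{n\to\infty} p_n=\ell$, if for every $\epsilon>0$, $\delta(\{k\in\mathbb N:|p_k-\ell|>\epsilon\})=0$. $st\subset l_\infty$ is the subspace of all bounded statistically convergent real sequences, and $g:st\to\mathbb R$, $g(x)=\mathrm{stat}\lim_{n\to\infty}x_n$,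 is the statistical limit functional. A linear functional $\mathcal F:l_\infty\to\mathbb R$ is a Banach statistical limit functional if: (i) $\|\mathcal F\|=1$; (ii) $\mathcal F|_{st}=g$; (iii) if $s\in l_\infty$ with $s_n\ge0$ a.a.$n$, then $\mathcal F(s)\ge0$; (iv) for every $x\in l_\infty$, $\mathcal F(x)=\mathcal F(Tx)$ for every map $T:l_\infty\to l_\infty$ such that $(Ty)_k=(Sy)_k$ a.a.$k$ for each $y\in l_\infty$. A sequence $x\in l_\infty$ is generalized almost statistically (GAS) convergent to $\lambda$ if $\mathcal F(x)=\lambda$ for all Banach statistical limit functionals $\mathcal F$; it is GAS convergent if this holds for some $\lambda\in\mathbb R$. $\mathcal S$ is the set of all GAS convergent real sequences. *)

theory Defs
  imports "HOL-Analysis.Analysis"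
begin

text \<open>
  Sequences are indexed from 0: the value at index \<^term>\<open>k :: nat\<close> is the (k+1)-st term of the
  sequence, so the initial segment {1, ..., n} of the positive integers becomes
  \<^term>\<open>{..<n :: nat}\<close>.

  Since \<^typ>\<open>nat\<close> carries the discrete topology, the bounded continuous functions from
  \<^typ>\<open>nat\<close> to \<^typ>\<open>real\<close> with the supremum norm are exactly the space of bounded real
  sequences (lemma bcontfun_nat_eq), and \<^typ>\<open>(nat \<Rightarrow>\<^sub>C real) \<Rightarrow>\<^sub>L real\<close> is its dual
  with the operator norm.
\<close>

type_synonym linf = "nat \<Rightarrow>\<^sub>C real"

lemma bcontfun_nat_eq: "(bcontfun :: (nat \<Rightarrow> real) set) = {x. bounded (range x)}"
  by (auto simp: bcontfun_def)

definition shift :: "linf \<Rightarrow> linf" where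
  "shift x = Bcontfun (\<lambda>n. apply_bcontfun x (Suc n))"

lemma apply_shift: "apply_bcontfun (shift x) n = apply_bcontfun x (Suc n)"
proof -
  have "bounded (range (\<lambda>n. apply_bcontfun x (Suc n)))"
    by (rule bounded_subset[OF bounded_apply_bcontfun[of x]]) auto
  then have "(\<lambda>n. apply_bcontfun x (Suc n)) \<in> bcontfun"
    by (simp add: bcontfun_nat_eq)
  then show ?thesis
    by (simp add: shift_def Bcontfun_inverse)
qed


subsection \<open>Banach limits and almost convergence\<close>

definition banach_limit :: "(linf \<Rightarrow>\<^sub>L real) \<Rightarrow> bool" where
  "banach_limit B \<longleftrightarrow>
     norm B = 1 \<and>
     (\<forall>x. convergent (apply_bcontfun x) \<longrightarrow> blinfun_apply B x = lim (apply_bcontfun x)) \<and>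
     (\<forall>x. (\<forall>n. apply_bcontfun x n \<ge> 0) \<longrightarrow> blinfun_apply B x \<ge> 0) \<and>
     (\<forall>x. blinfun_apply B x = blinfun_apply B (shift x))"

definition almost_convergent_to :: "linf \<Rightarrow> real \<Rightarrow> bool" where
  "almost_convergent_to x \<kappa> \<longleftrightarrow> (\<forall>B. banach_limit B \<longrightarrow> blinfun_apply B x = \<kappa>)"

definition almost_convergent_seqs :: "linf set" where
  "almost_convergent_seqs = {x. \<exists>\<kappa>. almost_convergent_to x \<kappa>}"


subsection \<open>Natural density and statistical convergence\<close>

definition has_density :: "nat set \<Rightarrow> real \<Rightarrow> bool" where
  "has_density P d \<longleftrightarrow> (\<lambda>n. real (card (P \<inter> {..<n})) / real n) \<longlonglongrightarrow> d"

definition almost_all :: "(nat \<Rightarrow> bool) \<Rightarrow> bool" where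
  "almost_all Q \<longleftrightarrow> has_density {k. \<not> Q k} 0"

definition stat_converges_to :: "(nat \<Rightarrow> real) \<Rightarrow> real \<Rightarrow> bool" where
  "stat_converges_to p l \<longleftrightarrow> (\<forall>\<epsilon>>0. has_density {k. \<bar>p k - l\<bar> > \<epsilon>} 0)"

lemma stat_converges_to_unique:
  assumes "stat_converges_to p l" "stat_converges_to p m"
  shows "l = m"
proof (rule ccontr)
  assume "l \<noteq> m"
  define e where "e = \<bar>l - m\<bar> / 3"
  define A where "A = {k. \<bar>p k - l\<bar> > e}"
  define B where "B = {k. \<bar>p k - m\<bar> > e}"
  have e: "e > 0" using \<open>l \<noteq> m\<close> by (simp add: e_def)
  have "A \<union> B = UNIV"
    using e unfolding A_def B_def e_def by (auto simp: abs_if split: if_splits)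
  then have "{..<n} = (A \<inter> {..<n}) \<union> (B \<inter> {..<n})" for n by blast
  then have card: "n \<le> card (A \<inter> {..<n}) + card (B \<inter> {..<n})" for n
    by (metis card_Un_le card_lessThan)
  have "(\<lambda>n. real (card (A \<inter> {..<n})) / real n + real (card (B \<inter> {..<n})) / real n)
          \<longlonglongrightarrow> 0 + 0"
    using assms e unfolding stat_converges_to_def has_density_def A_def B_def
    by (intro tendsto_add) auto
  moreover have "1 \<le> real (card (A \<inter> {..<n})) / real n + real (card (B \<inter> {..<n})) / real n"
    if "n \<ge> 1" for n
    using card[of n] that by (simp add: add_divide_distrib[symmetric] le_divide_eq)
  ultimately have "(1::real) \<le> 0 + 0"
    by (intro LIMSEQ_le_const) auto
  then show False by simp
qed

definition stat_lim :: "(nat \<Rightarrow> real) \<Rightarrow> real" where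
  "stat_lim p = (THE l. stat_converges_to p l)"

definition stat_convergent_seqs :: "linf set" where
  "stat_convergent_seqs = {x. \<exists>l. stat_converges_to (apply_bcontfun x) l}"


subsection \<open>Banach statistical limits and GAS convergence\<close>

text \<open>In the last clause T ranges over arbitrary, not necessarily linear, maps.\<close>

definition banach_stat_limit :: "(linf \<Rightarrow>\<^sub>L real) \<Rightarrow> bool" where
  "banach_stat_limit F \<longleftrightarrow>
     norm F = 1 \<and>
     (\<forall>x\<in>stat_convergent_seqs. blinfun_apply F x = stat_lim (apply_bcontfun x)) \<and>
     (\<forall>s. almost_all (\<lambda>n. apply_bcontfun s n \<ge> 0) \<longrightarrow> blinfun_apply F s \<ge> 0) \<and>
     (\<forall>x. \<forall>T :: linf \<Rightarrow> linf.
        (\<forall>y. almost_all (\<lambda>k. apply_bcontfun (T y) k = apply_bcontfun (shift y) k)) \<longrightarrow>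
        blinfun_apply F x = blinfun_apply F (T x))"

definition GAS_convergent_to :: "linf \<Rightarrow> real \<Rightarrow> bool" where
  "GAS_convergent_to x l \<longleftrightarrow> (\<forall>F. banach_stat_limit F \<longrightarrow> blinfun_apply F x = l)"

definition GAS_convergent_seqs :: "linf set" where
  "GAS_convergent_seqs = {x. \<exists>l. GAS_convergent_to x l}"

end

theory Submission
  imports Defs "HOL-Real_Asymp.Real_Asymp"
begin

text \<open>
  Every Banach statistical limit is a Banach limit: a convergent sequence is statistically
  convergent to the same value, and the shift itself is one of the maps T allowed in the last
  clause of the definition. Hence almost convergent sequences are GAS convergent, and statistically
  convergent ones are so by the second clause. Since GAS convergence is linear, a sequence outside
  both classes can be sought as a sum \<open>\<xi> = a + b\<close> of one member of each: \<open>a\<close> should spoil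
  statistical convergence and \<open>b\<close> should spoil almost convergence.

  The choice is \<open>a\<^sub>n = (-1)\<^sup>n\<close>, which every Banach limit sends to 0 because its shift is
  its negative, and the indicator \<open>b\<close> of the set of all \<open>n\<close> with \<open>2\<^sup>k \<le> n < 2\<^sup>k + k\<close> for some \<open>k\<close>.
  This set has density 0, since at most about \<open>(log n)\<^sup>2\<close> of its elements lie below \<open>n\<close>, so
  \<open>b\<close> is statistically null and every Banach statistical limit sends \<open>\<xi>\<close> to 0. Consecutive terms
  \<open>\<xi>\<^sub>2\<^sub>n\<close> and \<open>\<xi>\<^sub>2\<^sub>n\<^sub>+\<^sub>1\<close> differ by at least 1, which forbids statistical convergence
  (lemma \<open>not_stat_convergent_if_oscillating\<close>).

  It remains to see that \<open>\<xi>\<close> is not almost convergent, for which two Banach limits differing on \<open>b\<close>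
  are needed. They are produced by averaging over longer and longer intervals
  \<open>{s k ..< s k + k}\<close> and passing to a cluster point of the averaging functionals, which exists by
  Tychonoff's theorem (lemmas \<open>functional_cluster_point\<close> and \<open>banach_limit_of_interval_means\<close>).
  The intervals starting at \<open>2\<^sup>k\<close> are filled by the support of \<open>b\<close> and give the value 1; those
  starting at \<open>2\<^sup>k + k\<close> miss it and give the value 0.
\<close>

section \<open>Density and statistical convergence\<close>

lemma has_density_finite:
  assumes "finite A"
  shows "has_density A 0"
  unfolding has_density_def
proof (rule tendsto_sandwich[where f = "\<lambda>_. 0"])
  show "\<forall>\<^sub>F n in sequentially. real (card (A \<inter> {..<n})) / real n \<le> real (card A) / real n"
    using assms by (intro always_eventually allI divide_right_mono) (auto intro: card_mono)
  show "(\<lambda>n. real (card A) / real n) \<longlonglongrightarrow> 0"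
    by real_asymp
qed auto

lemma stat_lim_eq: "stat_converges_to p l \<Longrightarrow> stat_lim p = l"
  unfolding stat_lim_def by (blast intro: stat_converges_to_unique)

lemma stat_converges_to_if_LIMSEQ:
  assumes "p \<longlonglongrightarrow> l"
  shows "stat_converges_to p l"
  unfolding stat_converges_to_def
proof (intro allI impI has_density_finite)
  fix e :: real assume "e > 0"
  then obtain N where N: "\<And>n. n \<ge> N \<Longrightarrow> \<bar>p n - l\<bar> < e"
    using LIMSEQ_D[OF assms, of e] by auto
  have "{k. \<bar>p k - l\<bar> > e} \<subseteq> {..<N}"
    using N by (force simp: not_less[symmetric])
  then show "finite {k. \<bar>p k - l\<bar> > e}"
    by (rule finite_subset) simp
qed

text \<open>
  Among any two consecutive terms \<open>p\<^sub>2\<^sub>n\<close>, \<open>p\<^sub>2\<^sub>n\<^sub>+\<^sub>1\<close> at least one is far from a proposed limit, so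
  the exceptional set has lower density at least 1/2.
\<close>

lemma not_stat_convergent_if_oscillating:
  assumes osc: "\<And>n. \<bar>p (2 * n) - p (2 * n + 1)\<bar> \<ge> c" and "c > 0"
  shows "\<not> stat_converges_to p l"
proof
  assume "stat_converges_to p l"
  define E where "E = {k. \<bar>p k - l\<bar> > c / 3}"
  have "has_density E 0"
    using \<open>stat_converges_to p l\<close>[unfolded stat_converges_to_def, rule_format, of "c / 3"]
      \<open>c > 0\<close> unfolding E_def by fastforce
  then have lim: "(\<lambda>n. real (card (E \<inter> {..<n})) / real n) \<longlonglongrightarrow> 0"
    by (simp add: has_density_def)
  define f where "f n = (if 2 * n \<in> E then 2 * n else 2 * n + 1)" for n
  have fE: "f n \<in> E" for n
    using osc[of n] \<open>c > 0\<close> by (auto simp: f_def E_def abs_if split: if_splits)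
  have card: "n \<le> card (E \<inter> {..<2 * n})" for n
  proof -
    have "inj_on f {..<n}"
      by (auto simp: inj_on_def f_def split: if_splits)
    moreover have "f ` {..<n} \<subseteq> E \<inter> {..<2 * n}"
      using fE by (force simp: f_def)
    ultimately show ?thesis
      using card_inj_on_le[of f "{..<n}" "E \<inter> {..<2 * n}"] by simp
  qed
  have "(\<lambda>n. real (card (E \<inter> {..<2 * n})) / real (2 * n)) \<longlonglongrightarrow> 0"
    using LIMSEQ_subseq_LIMSEQ[OF lim, of "\<lambda>n. 2 * n"] by (simp add: strict_mono_def o_def)
  moreover have "1 / 2 \<le> real (card (E \<inter> {..<2 * n})) / real (2 * n)" if "n \<ge> 1" for n
    using card[of n] that by (simp add: field_simps)
  ultimately have "(1 / 2 :: real) \<le> 0"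
    using LIMSEQ_le_const by blast
  then show False by simp
qed


section \<open>Banach statistical limits are Banach limits\<close>

lemma banach_limit_if_banach_stat_limit:
  assumes F: "banach_stat_limit F"
  shows "banach_limit F"
  unfolding banach_limit_def
proof (intro conjI allI impI)
  have everywhere: "almost_all Q" if "\<And>k. Q k" for Q
    using that by (simp add: almost_all_def has_density_finite)
  show "norm F = 1"
    using F by (simp add: banach_stat_limit_def)
  show "blinfun_apply F x = lim (apply_bcontfun x)" if "convergent (apply_bcontfun x)" for x
  proof -
    have st: "stat_converges_to (apply_bcontfun x) (lim (apply_bcontfun x))"
      using that by (simp add: convergent_LIMSEQ_iff stat_converges_to_if_LIMSEQ)
    then have "blinfun_apply F x = stat_lim (apply_bcontfun x)"
      using F by (auto simp: banach_stat_limit_def stat_convergent_seqs_def)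
    then show ?thesis
      using stat_lim_eq[OF st] by simp
  qed
  show "blinfun_apply F x \<ge> 0" if "\<forall>n. apply_bcontfun x n \<ge> 0" for x
    using F that everywhere by (simp add: banach_stat_limit_def)
  show "blinfun_apply F x = blinfun_apply F (shift x)" for x
    using F everywhere by (simp add: banach_stat_limit_def)
qed

lemma almost_convergent_imp_GAS: "almost_convergent_seqs \<subseteq> GAS_convergent_seqs"
  unfolding almost_convergent_seqs_def GAS_convergent_seqs_def almost_convergent_to_def
    GAS_convergent_to_def
  using banach_limit_if_banach_stat_limit by blast

lemma GAS_convergent_to_stat_limit:
  assumes "stat_converges_to (apply_bcontfun x) l"
  shows "GAS_convergent_to x l"
  using assms stat_lim_eq[OF assms]
  by (auto simp: GAS_convergent_to_def banach_stat_limit_def stat_convergent_seqs_def)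

lemma stat_convergent_imp_GAS: "stat_convergent_seqs \<subseteq> GAS_convergent_seqs"
  using GAS_convergent_to_stat_limit
  by (auto simp: stat_convergent_seqs_def GAS_convergent_seqs_def)


section \<open>Banach limits from interval means\<close>

text \<open>
  The functionals bounded by the norm form a compact product of intervals, so a sequence of them
  has a cluster point; refining the sequential filter by the neighbourhoods of that point turns
  clustering into convergence. The filter \<open>G\<close> takes the place of an ultrafilter.
\<close>

lemma functional_cluster_point:
  fixes M :: "nat \<Rightarrow> 'a::real_normed_vector \<Rightarrow> real"
  assumes "\<And>k x. \<bar>M k x\<bar> \<le> norm x"
  obtains G L where "G \<noteq> bot" "G \<le> sequentially" "\<And>x. ((\<lambda>k. M k x) \<longlongrightarrow> L x) G"
proof -
  define U :: "('a \<Rightarrow> real) set" where "U = PiE UNIV (\<lambda>x. {- norm x..norm x})"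
  have "compactin (product_topology (\<lambda>x. euclidean) UNIV) U"
    unfolding U_def compactin_PiE by simp
  then have "compact U"
    by (simp add: euclidean_product_topology)
  moreover have "\<forall>\<^sub>F f in filtermap M sequentially. f \<in> U"
    unfolding eventually_filtermap
    using assms by (intro always_eventually) (auto simp: U_def abs_le_iff minus_le_iff)
  moreover have "filtermap M sequentially \<noteq> bot"
    by (simp add: filtermap_bot_iff)
  ultimately obtain L where L: "inf (nhds L) (filtermap M sequentially) \<noteq> bot"
    unfolding compact_filter by blast
  define G where "G = inf (filtercomap M (nhds L)) sequentially"
  have "G \<noteq> bot"
  proof
    assume "G = bot"
    then have "eventually (\<lambda>_. False) G" by simp
    then obtain P Q where P: "eventually P (filtercomap M (nhds L))"
      and Q: "eventually Q sequentially" and PQ: "\<And>k. P k \<Longrightarrow> Q k \<Longrightarrow> False"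
      unfolding G_def eventually_inf by blast
    from P obtain P' where P': "eventually P' (nhds L)" "\<And>k. P' (M k) \<Longrightarrow> P k"
      unfolding eventually_filtercomap by blast
    have "eventually (\<lambda>f. \<not> P' f) (filtermap M sequentially)"
      unfolding eventually_filtermap using Q by eventually_elim (use PQ P'(2) in blast)
    with P'(1) have "eventually (\<lambda>_. False) (inf (nhds L) (filtermap M sequentially))"
      unfolding eventually_inf by blast
    with L show False by (simp add: trivial_limit_def)
  qed
  moreover have "G \<le> sequentially"
    by (simp add: G_def)
  moreover have "((\<lambda>k. M k x) \<longlongrightarrow> L x) G" for x
  proof -
    have "filterlim M (nhds L) G"
      unfolding G_def filterlim_iff_le_filtercomap by simp
    then show ?thesis
      by (rule continuous_on_tendsto_compose[OF continuous_on_product_coordinates]) auto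
  qed
  ultimately show thesis by (rule that)
qed

definition interval_mean :: "(nat \<Rightarrow> nat) \<Rightarrow> nat \<Rightarrow> linf \<Rightarrow> real" where
  "interval_mean s k x = (\<Sum>j<k. apply_bcontfun x (s k + j)) / real k"

lemma interval_mean_near:
  assumes "k > 0" and "\<And>j. j < k \<Longrightarrow> \<bar>apply_bcontfun x (s k + j) - l\<bar> \<le> e"
  shows "\<bar>interval_mean s k x - l\<bar> \<le> e"
proof -
  have "interval_mean s k x - l = (\<Sum>j<k. apply_bcontfun x (s k + j) - l) / real k"
    using assms(1) by (simp add: interval_mean_def sum_subtractf diff_divide_distrib)
  then have "\<bar>interval_mean s k x - l\<bar> = \<bar>\<Sum>j<k. apply_bcontfun x (s k + j) - l\<bar> / real k"
    by simp
  moreover have "\<bar>\<Sum>j<k. apply_bcontfun x (s k + j) - l\<bar> \<le> real k * e"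
    using sum_norm_le[of "{..<k}" "\<lambda>j. apply_bcontfun x (s k + j) - l" "\<lambda>_. e"] assms(2)
    by simp
  ultimately show ?thesis
    using assms(1) by (simp add: pos_divide_le_eq mult.commute)
qed

lemma interval_mean_bound: "\<bar>interval_mean s k x\<bar> \<le> norm x"
proof (cases "k = 0")
  case False
  then show ?thesis
    using interval_mean_near[of k x s 0 "norm x"] norm_bounded[of x] by simp
qed (simp add: interval_mean_def)

lemma interval_mean_tendsto:
  assumes s: "filterlim s at_top sequentially" and x: "apply_bcontfun x \<longlonglongrightarrow> l"
  shows "(\<lambda>k. interval_mean s k x) \<longlonglongrightarrow> l"
proof (rule LIMSEQ_I)
  fix e :: real assume "e > 0"
  then obtain N where N: "\<And>n. n \<ge> N \<Longrightarrow> \<bar>apply_bcontfun x n - l\<bar> < e / 2"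
    using LIMSEQ_D[OF x, of "e / 2"] by auto
  have "\<forall>\<^sub>F k in sequentially. s k \<ge> N"
    using s by (simp add: filterlim_at_top)
  then have "\<forall>\<^sub>F k in sequentially. norm (interval_mean s k x - l) < e"
    using eventually_gt_at_top[of 0]
  proof eventually_elim
    case (elim k)
    then have "\<bar>interval_mean s k x - l\<bar> \<le> e / 2"
      using N by (intro interval_mean_near) (auto intro!: less_imp_le)
    with \<open>e > 0\<close> show ?case by simp
  qed
  then show "\<exists>no. \<forall>k\<ge>no. norm (interval_mean s k x - l) < e"
    by (simp add: eventually_sequentially)
qed

text \<open>Shifting moves the window by one place, so all but the two extreme terms cancel.\<close>

lemma interval_mean_shift:
  "(\<lambda>k. interval_mean s k x - interval_mean s k (shift x)) \<longlonglongrightarrow> 0"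
proof (rule Lim_null_comparison)
  have "\<bar>interval_mean s k x - interval_mean s k (shift x)\<bar> \<le> 2 * norm x / real k" for k
  proof -
    have "(\<Sum>j<k. apply_bcontfun x (s k + j)) - (\<Sum>j<k. apply_bcontfun (shift x) (s k + j))
        = apply_bcontfun x (s k) - apply_bcontfun x (s k + k)"
      using sum_lessThan_telescope'[of "\<lambda>j. apply_bcontfun x (s k + j)" k]
      by (simp add: apply_shift sum_subtractf)
    then have "\<bar>interval_mean s k x - interval_mean s k (shift x)\<bar>
        = \<bar>apply_bcontfun x (s k) - apply_bcontfun x (s k + k)\<bar> / real k"
      by (simp add: interval_mean_def diff_divide_distrib[symmetric] del: minus_bcontfun.rep_eq)
    also have "\<dots> \<le> 2 * norm x / real k"
      using norm_bounded[of x "s k"] norm_bounded[of x "s k + k"]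
      by (intro divide_right_mono) auto
    finally show ?thesis .
  qed
  then show "\<forall>\<^sub>F k in sequentially.
      norm (interval_mean s k x - interval_mean s k (shift x)) \<le> 2 * norm x / real k"
    by simp
  show "(\<lambda>k. 2 * norm x / real k) \<longlonglongrightarrow> 0"
    by real_asymp
qed

lemma banach_limit_of_interval_means:
  assumes s: "filterlim s at_top sequentially"
  obtains B where "banach_limit B"
    "\<And>x l. (\<lambda>k. interval_mean s k x) \<longlonglongrightarrow> l \<Longrightarrow> blinfun_apply B x = l"
proof -
  obtain G L where G: "G \<noteq> bot" "G \<le> sequentially"
    and L: "\<And>x. ((\<lambda>k. interval_mean s k x) \<longlongrightarrow> L x) G"
    using functional_cluster_point[of "interval_mean s"] interval_mean_bound by metis
  have L_eq: "L x = l" if "(\<lambda>k. interval_mean s k x) \<longlonglongrightarrow> l" for x l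
    using tendsto_unique[OF G(1) L tendsto_mono[OF G(2) that]] .
  have L_bound: "\<bar>L x\<bar> \<le> norm x" for x
    using tendsto_upperbound[OF tendsto_rabs[OF L] _ G(1)] interval_mean_bound by simp
  have "bounded_linear L"
  proof (rule bounded_linear_intro)
    show "L (x + y) = L x + L y" for x y
    proof (rule tendsto_unique[OF G(1) L])
      have "interval_mean s k (x + y) = interval_mean s k x + interval_mean s k y" for k
        by (simp add: interval_mean_def sum.distrib add_divide_distrib)
      then show "((\<lambda>k. interval_mean s k (x + y)) \<longlongrightarrow> L x + L y) G"
        using tendsto_add[OF L L] by simp
    qed
    show "L (r *\<^sub>R x) = r *\<^sub>R L x" for r x
    proof (rule tendsto_unique[OF G(1) L])
      have "interval_mean s k (r *\<^sub>R x) = r * interval_mean s k x" for k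
        by (simp add: interval_mean_def sum_distrib_left)
      then show "((\<lambda>k. interval_mean s k (r *\<^sub>R x)) \<longlongrightarrow> r *\<^sub>R L x) G"
        using tendsto_mult[OF tendsto_const L] by simp
    qed
    show "norm (L x) \<le> norm x * 1" for x
      using L_bound by simp
  qed
  then have B: "blinfun_apply (Blinfun L) = L"
    by (rule bounded_linear_Blinfun_apply)
  have L_lim: "L x = l" if "apply_bcontfun x \<longlonglongrightarrow> l" for x l
    by (rule L_eq[OF interval_mean_tendsto[OF s that]])
  have "banach_limit (Blinfun L)"
    unfolding banach_limit_def B
  proof (intro conjI allI impI)
    show "norm (Blinfun L) = 1"
    proof (rule antisym)
      show "norm (Blinfun L) \<le> 1"
        by (rule norm_blinfun_bound) (use L_bound in \<open>auto simp: B\<close>)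
      let ?u = "const_bcontfun 1 :: linf"
      have "L ?u = 1"
        by (rule L_lim) (simp add: tendsto_const)
      moreover have "norm ?u \<le> 1"
        by (rule norm_bound) simp
      ultimately show "1 \<le> norm (Blinfun L)"
        using norm_blinfun[of "Blinfun L" ?u]
          mult_left_mono[of "norm ?u" 1 "norm (Blinfun L)"] by (simp add: B)
    qed
    show "L x = lim (apply_bcontfun x)" if "convergent (apply_bcontfun x)" for x
      using that by (intro L_lim) (simp add: convergent_LIMSEQ_iff)
    show "L x \<ge> 0" if "\<forall>n. apply_bcontfun x n \<ge> 0" for x
    proof (rule tendsto_lowerbound[OF L _ G(1)])
      show "\<forall>\<^sub>F k in G. 0 \<le> interval_mean s k x"
        using that by (simp add: interval_mean_def sum_nonneg)
    qed
    show "L x = L (shift x)" for x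
      using tendsto_unique[OF G(1) tendsto_diff[OF L L]
          tendsto_mono[OF G(2) interval_mean_shift[of s x]]] by simp
  qed
  then show thesis
    by (rule that) (simp add: B L_eq)
qed

lemma banach_limit_of_constant_intervals:
  assumes "filterlim s at_top sequentially"
    and "\<And>k j. j < k \<Longrightarrow> apply_bcontfun x (s k + j) = c"
  obtains B where "banach_limit B" "blinfun_apply B x = c"
proof -
  have "\<forall>\<^sub>F k in sequentially. c = interval_mean s k x"
    using eventually_gt_at_top[of 0]
  proof eventually_elim
    case (elim k)
    then show ?case
      using interval_mean_near[of k x s c 0] assms(2) by simp
  qed
  then have "(\<lambda>k. interval_mean s k x) \<longlonglongrightarrow> c"
    by (rule Lim_transform_eventually[OF tendsto_const])
  then show thesis
    using banach_limit_of_interval_means[OF assms(1)] that by metis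
qed


section \<open>The alternating sequence and the sparse blocks\<close>

definition alternating :: linf where
  "alternating = Bcontfun (\<lambda>n. (- 1) ^ n)"

lemma apply_alternating: "apply_bcontfun alternating n = (- 1) ^ n"
proof -
  have "(\<lambda>n :: nat. (- 1) ^ n :: real) \<in> bcontfun"
    unfolding bcontfun_nat_eq by (auto intro!: boundedI[of _ 1])
  then show ?thesis
    by (simp add: alternating_def Bcontfun_inverse)
qed

lemma banach_limit_alternating:
  assumes "banach_limit B"
  shows "blinfun_apply B alternating = 0"
proof -
  have "shift alternating = - alternating"
    by (rule bcontfun_eqI) (simp add: apply_shift apply_alternating)
  then have "blinfun_apply B alternating = - blinfun_apply B alternating"
    using assms by (metis banach_limit_def blinfun.minus_right)
  then show ?thesis by simp
qed

definition blocks :: "nat set" where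
  "blocks = (\<Union>k. {2 ^ k..<2 ^ k + k})"

lemma in_blocks: "j < k \<Longrightarrow> 2 ^ k + j \<in> blocks"
  unfolding blocks_def by (rule UN_I[of k]) auto

text \<open>The gap after the k-th block has length \<open>2\<^sup>k - k \<ge> k\<close>.\<close>

lemma notin_blocks:
  assumes "j < k"
  shows "2 ^ k + k + j \<notin> blocks"
proof
  assume "2 ^ k + k + j \<in> blocks"
  then obtain m where m: "2 ^ m \<le> 2 ^ k + k + j" "2 ^ k + k + j < 2 ^ m + m"
    by (auto simp: blocks_def)
  show False
  proof (cases "m \<le> k")
    case True
    then have "(2::nat) ^ m \<le> 2 ^ k"
      by (simp add: power_increasing)
    with m(2) True show False by linarith
  next
    case False
    then have "(2::nat) ^ Suc k \<le> 2 ^ m"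
      by (intro power_increasing) auto
    moreover have "2 * k \<le> 2 ^ k"
    proof (induction k)
      case (Suc k)
      then show ?case by (cases k) auto
    qed simp
    ultimately show False
      using m(1) assms by simp
  qed
qed

text \<open>
  Only the blocks with \<open>2\<^sup>k < n\<close> meet \<open>{..<n}\<close>; there are about \<open>log n\<close> of them, each of length at
  most \<open>log n\<close>.
\<close>

lemma has_density_blocks: "has_density blocks 0"
  unfolding has_density_def
proof (rule tendsto_sandwich[where f = "\<lambda>_. 0"])
  show "(\<lambda>n. (log 2 (real n) + 1) ^ 2 / real n) \<longlonglongrightarrow> 0"
    by real_asymp
  have "real (card (blocks \<inter> {..<n})) \<le> (log 2 (real n) + 1) ^ 2" if "n > 0" for n
  proof -
    define K where "K = nat \<lceil>log 2 (real n)\<rceil>"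
    have log: "log 2 (real n) \<ge> 0"
      using that by simp
    then have K: "log 2 (real n) \<le> real K" "real K \<le> log 2 (real n) + 1"
      unfolding K_def by linarith+
    have "real n \<le> 2 powr real K"
      using K(1) that by (simp add: log_le_iff)
    then have n: "n \<le> 2 ^ K"
      by (simp add: powr_realpow flip: of_nat_le_iff)
    have "blocks \<inter> {..<n} \<subseteq> (\<Union>k<K. {2 ^ k..<2 ^ k + k})"
    proof
      fix i assume "i \<in> blocks \<inter> {..<n}"
      then obtain k where k: "2 ^ k \<le> i" "i < 2 ^ k + k" "i < n"
        by (auto simp: blocks_def)
      then have "(2::nat) ^ k < 2 ^ K"
        using n by linarith
      then have "k < K" by simp
      with k show "i \<in> (\<Union>k<K. {2 ^ k..<2 ^ k + k})" by auto
    qed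
    then have "card (blocks \<inter> {..<n}) \<le> card (\<Union>k<K. {2 ^ k..<2 ^ k + k})"
      by (intro card_mono) auto
    also have "\<dots> \<le> (\<Sum>k<K. card {2 ^ k..<2 ^ k + k})"
      by (rule card_UN_le) simp
    also have "\<dots> \<le> K ^ 2"
      using sum_bounded_above[of "{..<K}" "\<lambda>k. k" K] by (simp add: power2_eq_square)
    finally have "real (card (blocks \<inter> {..<n})) \<le> real K ^ 2"
      by (simp flip: of_nat_power)
    also have "\<dots> \<le> (log 2 (real n) + 1) ^ 2"
      using K(2) by (intro power_mono) auto
    finally show ?thesis .
  qed
  then show "\<forall>\<^sub>F n in sequentially.
      real (card (blocks \<inter> {..<n})) / real n \<le> (log 2 (real n) + 1) ^ 2 / real n"
    by (intro eventually_mono[OF eventually_gt_at_top[of 0]] divide_right_mono) auto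
qed auto

definition block_indicator :: linf where
  "block_indicator = Bcontfun (indicator blocks)"

lemma apply_block_indicator: "apply_bcontfun block_indicator n = indicator blocks n"
proof -
  have "(indicator blocks :: nat \<Rightarrow> real) \<in> bcontfun"
    unfolding bcontfun_nat_eq by (auto intro!: boundedI[of _ 1] simp: indicator_def)
  then show ?thesis
    by (simp add: block_indicator_def Bcontfun_inverse)
qed

lemma stat_converges_to_block_indicator:
  "stat_converges_to (apply_bcontfun block_indicator) 0"
  unfolding stat_converges_to_def
proof (intro allI impI)
  fix e :: real assume "e > 0"
  show "has_density {k. \<bar>apply_bcontfun block_indicator k - 0\<bar> > e} 0"
  proof (cases "e < 1")
    case True
    then have "{k. \<bar>apply_bcontfun block_indicator k - 0\<bar> > e} = blocks"
      using \<open>e > 0\<close> by (auto simp: apply_block_indicator indicator_def)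
    then show ?thesis by (simp add: has_density_blocks)
  next
    case False
    then have "{k. \<bar>apply_bcontfun block_indicator k - 0\<bar> > e} = {}"
      by (auto simp: apply_block_indicator indicator_def)
    then show ?thesis by (simp add: has_density_finite)
  qed
qed

lemma banach_limits_differ_on_block_indicator:
  obtains B1 B2 where "banach_limit B1" "blinfun_apply B1 block_indicator = 1"
    "banach_limit B2" "blinfun_apply B2 block_indicator = 0"
proof -
  have "filterlim (\<lambda>k. 2 ^ k :: nat) at_top sequentially"
    by (rule filterlim_at_top_mono[OF filterlim_ident]) (simp add: less_imp_le)
  then obtain B1 where "banach_limit B1" "blinfun_apply B1 block_indicator = 1"
    by (rule banach_limit_of_constant_intervals[where x = block_indicator and c = 1])
      (auto simp: apply_block_indicator in_blocks)
  moreover have "filterlim (\<lambda>k. 2 ^ k + k :: nat) at_top sequentially"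
    by (rule filterlim_at_top_mono[OF filterlim_ident]) simp
  then obtain B2 where "banach_limit B2" "blinfun_apply B2 block_indicator = 0"
    by (rule banach_limit_of_constant_intervals[where x = block_indicator and c = 0])
      (auto simp: apply_block_indicator notin_blocks)
  ultimately show thesis by (rule that)
qed

theorem mainTheorem4:
  shows "(\<exists>\<xi> \<in> GAS_convergent_seqs. \<xi> \<notin> almost_convergent_seqs \<and> \<xi> \<notin> stat_convergent_seqs)
    \<and> stat_convergent_seqs \<union> almost_convergent_seqs \<subset> GAS_convergent_seqs"
proof -
  define \<xi> where "\<xi> = alternating + block_indicator"
  have B_\<xi>: "blinfun_apply B \<xi> = blinfun_apply B block_indicator" if "banach_limit B" for B
    using banach_limit_alternating[OF that] by (simp add: \<xi>_def blinfun.add_right)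
  have "GAS_convergent_to \<xi> 0"
    using GAS_convergent_to_stat_limit[OF stat_converges_to_block_indicator]
    by (simp add: GAS_convergent_to_def B_\<xi> banach_limit_if_banach_stat_limit)
  then have GAS: "\<xi> \<in> GAS_convergent_seqs"
    by (auto simp: GAS_convergent_seqs_def)
  have not_almost: "\<xi> \<notin> almost_convergent_seqs"
  proof
    assume "\<xi> \<in> almost_convergent_seqs"
    then obtain \<kappa> where \<kappa>: "\<And>B. banach_limit B \<Longrightarrow> blinfun_apply B block_indicator = \<kappa>"
      using B_\<xi> by (auto simp: almost_convergent_seqs_def almost_convergent_to_def)
    show False
      by (rule banach_limits_differ_on_block_indicator) (use \<kappa> in force)
  qed
  have "\<bar>apply_bcontfun \<xi> (2 * n) - apply_bcontfun \<xi> (2 * n + 1)\<bar> \<ge> 1" for n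
    by (simp add: \<xi>_def apply_alternating apply_block_indicator indicator_def)
  then have not_stat: "\<xi> \<notin> stat_convergent_seqs"
    using not_stat_convergent_if_oscillating[of 1 "apply_bcontfun \<xi>"]
    by (auto simp: stat_convergent_seqs_def)
  show ?thesis
    using GAS not_almost not_stat almost_convergent_imp_GAS stat_convergent_imp_GAS by blast
qed

end
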